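(* Let $(A,\mu,\Delta)$ be an $\epsilon$-bialgebra with balanceator $B$ and $\alpha\colon A\to A$ be an $\epsilon$-bialgebra morphism. Then the balanceator $B_\alpha$ of the $\epsilon$-Hom-bialgebra $A_\alpha=(A,\mu_\alpha=\alpha\circ\mu,\Delta_\alpha=\Delta\circ\alpha,\alpha)$ is given by $$B_\alpha=(\alpha^2)^{\otimes 2}\circ B.$$ In particular, if $B$ is symmetric, then so is $B_\alpha$. Conversely, if $B_\alpha$ is symmetric and $\alpha^{\otimes 2}$ is injective, then $B$ is symmetric.
   Context: Throughout, $\mathbf{k}$ is a fixed field of characteristic $0$; vector spaces, linear maps and tensor products are over $\mathbf{k}$. $\tau$ denotes the twist $\tau(x\otimes y)=y\otimes x$; $\alpha^2=\alpha\circ\alpha$. Algebras are not required to be unital. An $\epsilon$-Hom-bialgebra $(A,\mu,\Delta,\alpha)$ is a $\mathbf{k}$-vector space $A$ with linear maps $\mu\colon A^{\otimes 2}\to A$, $\Delta\colon A\to A^{\otimes 2}$, $\alpha\colon A\to A$ such that: $\alpha\circ\mu=\mu\circ\alpha^{\otimes 2}$; $\mu\circ(\alpha\otimes\mu)=\mu\circ(\mu\otimes\alpha)$; $\alpha^{\otimes 2}\circ\Delta=\Delta\circ\alpha$; $(\alpha\otimes\Delta)\circ\Delta=(\Delta\otimes\alpha)\circ\Delta$; and $\Delta\circ\mu=(\mu\otimes\alpha)\circ(\alpha\otimes\Delta)+(\alpha\otimes\mu)\circ(\Delta\otimes\alpha)$. An $\epsilon$-bialgebra is an $\epsilon$-Hom-bialgebra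 with $\alpha=Id$. A morphism of $\epsilon$-bialgebras is a linear map commuting with the multiplications and the comultiplications. If $(A,\mu,\Delta)$ is an $\epsilon$-bialgebra and $\alpha$ is an $\epsilon$-bialgebra morphism $A\to A$, then $A_\alpha$ is an $\epsilon$-Hom-bialgebra. In an $\epsilon$-Hom-bialgebra $(A,\mu,\Delta,\alpha)$, for $a\in A$ and $b=\sum b_1\otimes b_2\in A^{\otimes 2}$, set $[a,b]_\bullet=\sum\mu(\alpha(a),b_1)\otimes\alpha(b_2)-\alpha(b_1)\otimes\mu(b_2,\alpha(a))$. With $\Delta^{op}=\tau\circ\Delta$, the balanceator is the map $B\colon A^{\otimes 2}\to A^{\otimes 2}$, $$B(x,y)=[x,\Delta^{op}(y)]_\bullet+\tau([y,\Delta^{op}(x)]_\bullet),$$ all formed with the structure maps of the $\epsilon$-Hom-bialgebra in question (with $\alpha=Id$ for an $\epsilon$-bialgebra). The balanceator is symmetric if $B(x,y)=B(y,x)$ for all $x,y\in A$. *)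

theory Defs
  imports Complex_Main "HOL-Library.Poly_Mapping"
begin

section \<open>Tensor products of vector spaces\<close>

text \<open>
  The tensor product of vector spaces \<open>A\<close>, \<open>B\<close> over \<open>k\<close> is the free vector space on
  \<open>A \<times> B\<close> modulo the bilinearity relations. As the scalar multiplications of \<open>A\<close> and \<open>B\<close> are
  terms, this quotient cannot be a HOL type depending on them; instead, \<open>is_tensor_product sA sB sT t\<close>
  says that the type of \<open>sT\<close>, together with the pairing \<open>t x y = x \<otimes> y\<close>, is
  (canonically isomorphic to) this quotient: the canonical map from the free vector space onto it
  is surjective and its kernel is spanned by the bilinearity relations.
\<close>

definition free_scale :: "'k::field \<Rightarrow> ('i \<Rightarrow>\<^sub>0 'k) \<Rightarrow> ('i \<Rightarrow>\<^sub>0 'k)" where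
  "free_scale c f = Poly_Mapping.map ((*) c) f"

definition free_lift :: "('k::field \<Rightarrow> 'w::ab_group_add \<Rightarrow> 'w) \<Rightarrow> ('i \<Rightarrow> 'w) \<Rightarrow> ('i \<Rightarrow>\<^sub>0 'k) \<Rightarrow> 'w" where
  "free_lift sW \<beta> f = (\<Sum>i\<in>Poly_Mapping.keys f. sW (Poly_Mapping.lookup f i) (\<beta> i))"

definition bilinearity_relations ::
  "('k::field \<Rightarrow> 'a::ab_group_add \<Rightarrow> 'a) \<Rightarrow> ('k \<Rightarrow> 'b::ab_group_add \<Rightarrow> 'b) \<Rightarrow> (('a \<times> 'b) \<Rightarrow>\<^sub>0 'k) set" where
  "bilinearity_relations sA sB =
    (let e = (\<lambda>x y. Poly_Mapping.single (x, y) (1::'k)) in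
       {e (x + x') y - e x y - e x' y | x x' y. True}
     \<union> {e x (y + y') - e x y - e x y' | x y y'. True}
     \<union> {e (sA c x) y - free_scale c (e x y) | c x y. True}
     \<union> {e x (sB c y) - free_scale c (e x y) | c x y. True})"

definition is_tensor_product ::
  "('k::field \<Rightarrow> 'a::ab_group_add \<Rightarrow> 'a) \<Rightarrow> ('k \<Rightarrow> 'b::ab_group_add \<Rightarrow> 'b) \<Rightarrow>
   ('k \<Rightarrow> 't::ab_group_add \<Rightarrow> 't) \<Rightarrow> ('a \<Rightarrow> 'b \<Rightarrow> 't) \<Rightarrow> bool" where
  "is_tensor_product sA sB sT t \<longleftrightarrow>
     vector_space sA \<and> vector_space sB \<and> vector_space sT \<and>
     surj (free_lift sT (\<lambda>(x, y). t x y)) \<and>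
     {f. free_lift sT (\<lambda>(x, y). t x y) f = 0} = module.span free_scale (bilinearity_relations sA sB)"

definition bilinear_map ::
  "('k::field \<Rightarrow> 'a::ab_group_add \<Rightarrow> 'a) \<Rightarrow> ('k \<Rightarrow> 'b::ab_group_add \<Rightarrow> 'b) \<Rightarrow>
   ('k \<Rightarrow> 'w::ab_group_add \<Rightarrow> 'w) \<Rightarrow> ('a \<Rightarrow> 'b \<Rightarrow> 'w) \<Rightarrow> bool" where
  "bilinear_map sA sB sW \<beta> \<longleftrightarrow>
     (\<forall>x. Vector_Spaces.linear sB sW (\<beta> x)) \<and> (\<forall>y. Vector_Spaces.linear sA sW (\<lambda>x. \<beta> x y))"

text \<open>The linear map induced by a bilinear map \<open>\<beta>\<close>; see \<open>tensor_lift_linear\<close> and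
  \<open>tensor_lift_apply\<close> below.\<close>

definition tensor_lift ::
  "('k::field \<Rightarrow> 't::ab_group_add \<Rightarrow> 't) \<Rightarrow> ('a \<Rightarrow> 'b \<Rightarrow> 't) \<Rightarrow>
   ('k \<Rightarrow> 'w::ab_group_add \<Rightarrow> 'w) \<Rightarrow> ('a \<Rightarrow> 'b \<Rightarrow> 'w) \<Rightarrow> 't \<Rightarrow> 'w" where
  "tensor_lift sT t sW \<beta> =
     (THE h. Vector_Spaces.linear sT sW h \<and> (\<forall>x y. h (t x y) = \<beta> x y))"

lemma lookup_free_scale: "Poly_Mapping.lookup (free_scale c f) i = c * Poly_Mapping.lookup f i"
  by (simp add: free_scale_def Poly_Mapping.map.rep_eq when_def)

lemma vector_space_free: "vector_space (free_scale :: 'k::field \<Rightarrow> ('i \<Rightarrow>\<^sub>0 'k) \<Rightarrow> _)"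
  by unfold_locales
    (auto simp: poly_mapping_eq_iff fun_eq_iff lookup_add lookup_free_scale algebra_simps)

lemma free_lift_superset:
  assumes "vector_space sW" "finite S" "Poly_Mapping.keys f \<subseteq> S"
  shows "free_lift sW \<beta> f = (\<Sum>i\<in>S. sW (Poly_Mapping.lookup f i) (\<beta> i))"
proof -
  interpret W: vector_space sW by fact
  show ?thesis unfolding free_lift_def
    using assms(2,3) by (intro sum.mono_neutral_left) (auto simp: in_keys_iff)
qed

lemma free_lift_linear:
  assumes W: "vector_space sW"
  shows "Vector_Spaces.linear free_scale sW (free_lift sW \<beta>)"
proof -
  interpret W: vector_space sW by fact
  have add: "free_lift sW \<beta> (f + g) = free_lift sW \<beta> f + free_lift sW \<beta> g" for f g
  proof -
    let ?S = "Poly_Mapping.keys f \<union> Poly_Mapping.keys g"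
    have k: "Poly_Mapping.keys (f + g) \<subseteq> ?S" by (rule keys_add)
    show ?thesis
      using k by (simp add: free_lift_superset[OF W, of ?S] lookup_add W.scale_left_distrib sum.distrib)
  qed
  have scale: "free_lift sW \<beta> (free_scale c f) = sW c (free_lift sW \<beta> f)" for c f
  proof -
    have k: "Poly_Mapping.keys (free_scale c f) \<subseteq> Poly_Mapping.keys f"
      by (auto simp: in_keys_iff lookup_free_scale)
    show ?thesis
      using k by (simp add: free_lift_superset[OF W, of "Poly_Mapping.keys f"] lookup_free_scale W.scale_sum_right)
  qed
  show ?thesis using vector_space_free W add scale unfolding Vector_Spaces.linear_iff by auto
qed

lemma free_lift_single:
  assumes "vector_space sW"
  shows "free_lift sW \<beta> (Poly_Mapping.single i c) = sW c (\<beta> i)"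
proof -
  interpret W: vector_space sW by fact
  show ?thesis by (cases "c = 0") (simp_all add: free_lift_def)
qed

lemma free_lift_relations:
  fixes sA :: "'k::field \<Rightarrow> 'a::ab_group_add \<Rightarrow> 'a" and sB :: "'k \<Rightarrow> 'b::ab_group_add \<Rightarrow> 'b"
  assumes "bilinear_map sA sB sW \<beta>"
    and f: "f \<in> module.span free_scale (bilinearity_relations sA sB)"
  shows "free_lift sW (\<lambda>(x, y). \<beta> x y) f = 0"
proof -
  let ?\<phi> = "free_lift sW (\<lambda>(x, y). \<beta> x y)"
  have W: "vector_space sW" using assms(1) by (auto simp: bilinear_map_def Vector_Spaces.linear_iff)
  interpret W: vector_space sW by fact
  interpret F: vector_space "free_scale :: 'k \<Rightarrow> (('a \<times> 'b) \<Rightarrow>\<^sub>0 'k) \<Rightarrow> _" by (rule vector_space_free)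
  interpret P: Vector_Spaces.linear free_scale sW ?\<phi> by (rule free_lift_linear[OF W])
  have *: "?\<phi> f = 0" if "f \<in> bilinearity_relations sA sB" for f
    using that assms(1)
    by (auto simp: bilinearity_relations_def Let_def P.diff P.scale free_lift_single[OF W]
        bilinear_map_def Vector_Spaces.linear_iff)
  show ?thesis using f
    by (induct rule: F.span_induct_alt) (auto simp: P.zero P.add P.scale *)
qed

lemma is_tensor_product_bilinear:
  fixes sA :: "'k::field \<Rightarrow> 'a::ab_group_add \<Rightarrow> 'a" and sB :: "'k \<Rightarrow> 'b::ab_group_add \<Rightarrow> 'b"
  assumes "is_tensor_product sA sB sT t"
  shows "bilinear_map sA sB sT t"
proof -
  let ?\<phi> = "free_lift sT (\<lambda>(x, y). t x y)"
  have A: "vector_space sA" and B: "vector_space sB" and T: "vector_space sT"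
    and ker: "{f. ?\<phi> f = 0} = module.span free_scale (bilinearity_relations sA sB)"
    using assms by (auto simp: is_tensor_product_def)
  interpret T: vector_space sT by fact
  interpret F: vector_space "free_scale :: 'k \<Rightarrow> (('a \<times> 'b) \<Rightarrow>\<^sub>0 'k) \<Rightarrow> _" by (rule vector_space_free)
  interpret P: Vector_Spaces.linear free_scale sT ?\<phi> by (rule free_lift_linear[OF T])
  have rel: "?\<phi> f = 0" if "f \<in> bilinearity_relations sA sB" for f
    using ker F.span_base[OF that] by blast
  have mem:
    "Poly_Mapping.single (x + x', y) 1 - Poly_Mapping.single (x, y) 1 - Poly_Mapping.single (x', y) 1
      \<in> bilinearity_relations sA sB"
    "Poly_Mapping.single (x, y + y') 1 - Poly_Mapping.single (x, y) 1 - Poly_Mapping.single (x, y') 1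
      \<in> bilinearity_relations sA sB"
    "Poly_Mapping.single (sA c x, y) 1 - free_scale c (Poly_Mapping.single (x, y) 1)
      \<in> bilinearity_relations sA sB"
    "Poly_Mapping.single (x, sB c y) 1 - free_scale c (Poly_Mapping.single (x, y) 1)
      \<in> bilinearity_relations sA sB" for x x' y y' c
    unfolding bilinearity_relations_def Let_def by blast+
  note simps = P.diff P.scale free_lift_single[OF T] T.scale_one P.add
  have "t (x + x') y = t x y + t x' y" for x x' y
    using rel[OF mem(1)[of x x' y]] by (simp add: simps algebra_simps)
  moreover have "t x (y + y') = t x y + t x y'" for x y y'
    using rel[OF mem(2)[of x y y']] by (simp add: simps algebra_simps)
  moreover have "t (sA c x) y = sT c (t x y)" for c x y
    using rel[OF mem(3)[of c x y]] by (simp add: simps algebra_simps)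
  moreover have "t x (sB c y) = sT c (t x y)" for c x y
    using rel[OF mem(4)[of x c y]] by (simp add: simps algebra_simps)
  ultimately show ?thesis
    using A B T by (auto simp: bilinear_map_def Vector_Spaces.linear_iff)
qed

lemma tensor_product_ext:
  assumes "is_tensor_product sA sB sT t"
    and "Vector_Spaces.linear sT sW g" "Vector_Spaces.linear sT sW h"
    and eq: "\<And>x y. g (t x y) = h (t x y)"
  shows "g = h"
proof
  fix z
  interpret g: Vector_Spaces.linear sT sW g by fact
  interpret h: Vector_Spaces.linear sT sW h by fact
  from assms(1) obtain f where "z = free_lift sT (\<lambda>(x, y). t x y) f"
    unfolding is_tensor_product_def by (metis surjD)
  then show "g z = h z"
    by (simp add: free_lift_def g.sum h.sum g.scale h.scale eq case_prod_unfold)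
qed

text \<open>The universal property, for an arbitrary target space.\<close>

theorem tensor_product_universal:
  assumes T: "is_tensor_product sA sB sT t" and b: "bilinear_map sA sB sW \<beta>"
  shows "\<exists>!h. Vector_Spaces.linear sT sW h \<and> (\<forall>x y. h (t x y) = \<beta> x y)"
proof -
  let ?\<phi> = "free_lift sT (\<lambda>(x, y). t x y)" and ?\<psi> = "free_lift sW (\<lambda>(x, y). \<beta> x y)"
  have VT: "vector_space sT" and sj: "surj ?\<phi>"
    and ker: "{f. ?\<phi> f = 0} = module.span free_scale (bilinearity_relations sA sB)"
    using T by (auto simp: is_tensor_product_def)
  have VW: "vector_space sW" using b by (auto simp: bilinear_map_def Vector_Spaces.linear_iff)
  interpret VT: vector_space sT by fact
  interpret VW: vector_space sW by fact
  interpret P: Vector_Spaces.linear free_scale sT ?\<phi> by (rule free_lift_linear[OF VT])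
  interpret Q: Vector_Spaces.linear free_scale sW ?\<psi> by (rule free_lift_linear[OF VW])
  have fac: "?\<psi> f = ?\<psi> g" if "?\<phi> f = ?\<phi> g" for f g
  proof -
    have "?\<phi> (f - g) = 0" using that by (simp add: P.diff)
    then have "?\<psi> (f - g) = 0" using ker free_lift_relations[OF b] by blast
    then show ?thesis by (simp add: Q.diff)
  qed
  define h where "h z = ?\<psi> (inv ?\<phi> z)" for z
  have h: "h (?\<phi> f) = ?\<psi> f" for f
    unfolding h_def by (rule fac) (simp add: surj_f_inv_f[OF sj])
  have "h (u + v) = h u + h v" for u v
  proof -
    obtain f g where "u = ?\<phi> f" "v = ?\<phi> g" using sj by (metis surjD)
    then show ?thesis by (simp flip: P.add add: h Q.add)
  qed
  moreover have "h (sT c u) = sW c (h u)" for c u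
  proof -
    obtain f where "u = ?\<phi> f" using sj by (metis surjD)
    then show ?thesis by (simp flip: P.scale add: h Q.scale)
  qed
  ultimately have lin: "Vector_Spaces.linear sT sW h" using VT VW by (auto simp: Vector_Spaces.linear_iff)
  have "h (t x y) = \<beta> x y" for x y
    using h[of "Poly_Mapping.single (x, y) 1"] by (simp add: free_lift_single VT VW)
  with lin show ?thesis
    by (intro ex1I[of _ h]) (auto intro!: tensor_product_ext[OF T])
qed

lemma
  assumes "is_tensor_product sA sB sT t" and "bilinear_map sA sB sW \<beta>"
  shows tensor_lift_linear: "Vector_Spaces.linear sT sW (tensor_lift sT t sW \<beta>)"
    and tensor_lift_apply: "tensor_lift sT t sW \<beta> (t x y) = \<beta> x y"
  using theI'[OF tensor_product_universal[OF assms]] by (auto simp: tensor_lift_def)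

text \<open>\<open>tensor_map sP p sQ q f g\<close> is \<open>f \<otimes> g\<close>, from the tensor product with pairing \<open>p\<close> to the one
  with pairing \<open>q\<close>.\<close>

definition tensor_map ::
  "('k::field \<Rightarrow> 'p::ab_group_add \<Rightarrow> 'p) \<Rightarrow> ('a \<Rightarrow> 'b \<Rightarrow> 'p) \<Rightarrow>
   ('k \<Rightarrow> 'q::ab_group_add \<Rightarrow> 'q) \<Rightarrow> ('c \<Rightarrow> 'd \<Rightarrow> 'q) \<Rightarrow>
   ('a \<Rightarrow> 'c) \<Rightarrow> ('b \<Rightarrow> 'd) \<Rightarrow> 'p \<Rightarrow> 'q" where
  "tensor_map sP p sQ q f g = tensor_lift sP p sQ (\<lambda>x y. q (f x) (g y))"

lemma
  assumes P: "is_tensor_product sA sB sP p" and Q: "is_tensor_product sC sD sQ q"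
    and f: "Vector_Spaces.linear sA sC f" and g: "Vector_Spaces.linear sB sD g"
  shows tensor_map_linear: "Vector_Spaces.linear sP sQ (tensor_map sP p sQ q f g)"
    and tensor_map_apply: "tensor_map sP p sQ q f g (p x y) = q (f x) (g y)"
proof -
  have b: "bilinear_map sA sB sQ (\<lambda>x y. q (f x) (g y))"
    using is_tensor_product_bilinear[OF Q] f g by (auto simp: bilinear_map_def Vector_Spaces.linear_iff)
  show "Vector_Spaces.linear sP sQ (tensor_map sP p sQ q f g)"
    and "tensor_map sP p sQ q f g (p x y) = q (f x) (g y)"
    unfolding tensor_map_def by (rule tensor_lift_linear[OF P b] tensor_lift_apply[OF P b])+
qed

lemma tensor_map_comp:
  assumes P: "is_tensor_product sA sB sP p" and Q: "is_tensor_product sC sD sQ q"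
    and R: "is_tensor_product sE sF sR r"
    and f: "Vector_Spaces.linear sA sC f" and g: "Vector_Spaces.linear sB sD g"
    and f': "Vector_Spaces.linear sC sE f'" and g': "Vector_Spaces.linear sD sF g'"
  shows "tensor_map sQ q sR r f' g' (tensor_map sP p sQ q f g z) = tensor_map sP p sR r (f' \<circ> f) (g' \<circ> g) z"
proof -
  have ff: "Vector_Spaces.linear sA sE (f' \<circ> f)" and gg: "Vector_Spaces.linear sB sF (g' \<circ> g)"
    using f f' g g' by (auto simp: Vector_Spaces.linear_iff)
  have "(\<lambda>z. tensor_map sQ q sR r f' g' (tensor_map sP p sQ q f g z)) = tensor_map sP p sR r (f' \<circ> f) (g' \<circ> g)"
  proof (rule tensor_product_ext[OF P])
    show "Vector_Spaces.linear sP sR (\<lambda>z. tensor_map sQ q sR r f' g' (tensor_map sP p sQ q f g z))"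
      using tensor_map_linear[OF P Q f g] tensor_map_linear[OF Q R f' g'] by (auto simp: Vector_Spaces.linear_iff)
  qed (simp_all add: tensor_map_linear[OF P R ff gg] tensor_map_apply[OF P Q f g]
      tensor_map_apply[OF Q R f' g'] tensor_map_apply[OF P R ff gg])
  then show ?thesis by (rule fun_cong)
qed

section \<open>A vector space with its tensor square and tensor cube\<close>

text \<open>
  A vector space \<open>A\<close> with types for \<open>A \<otimes> A\<close> and \<open>A \<otimes> A \<otimes> A\<close>. The latter is both
  \<open>(A \<otimes> A) \<otimes> A\<close>, with pairing \<open>tenL\<close>, and \<open>A \<otimes> (A \<otimes> A)\<close>, with pairing \<open>tenR\<close>; the axiom
  \<open>tenL (ten x y) z = tenR x (ten y z)\<close> is the usual identification of the two.
\<close>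

record ('k, 'a, 't, 'u) tensor_powers =
  smult  :: "'k \<Rightarrow> 'a \<Rightarrow> 'a"
  smult2 :: "'k \<Rightarrow> 't \<Rightarrow> 't"
  smult3 :: "'k \<Rightarrow> 'u \<Rightarrow> 'u"
  ten  :: "'a \<Rightarrow> 'a \<Rightarrow> 't"
  tenL :: "'t \<Rightarrow> 'a \<Rightarrow> 'u"
  tenR :: "'a \<Rightarrow> 't \<Rightarrow> 'u"

definition is_tensor_powers ::
  "('k::field, 'a::ab_group_add, 't::ab_group_add, 'u::ab_group_add) tensor_powers \<Rightarrow> bool" where
  "is_tensor_powers V \<longleftrightarrow>
     is_tensor_product (smult V) (smult V) (smult2 V) (ten V) \<and>
     is_tensor_product (smult2 V) (smult V) (smult3 V) (tenL V) \<and>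
     is_tensor_product (smult V) (smult2 V) (smult3 V) (tenR V) \<and>
     (\<forall>x y z. tenL V (ten V x y) z = tenR V x (ten V y z))"

text \<open>\<open>tmap V f g\<close> is \<open>f \<otimes> g : A \<otimes> A \<rightarrow> A \<otimes> A\<close>. The suffixes \<open>toL\<close>, \<open>toR\<close>, \<open>fromL\<close>, \<open>fromR\<close> are used when the
  target or the source is \<open>A \<otimes> A \<otimes> A\<close>, split as \<open>(A \<otimes> A) \<otimes> A\<close> or \<open>A \<otimes> (A \<otimes> A)\<close>.\<close>

definition tmap ::
  "('k::field, 'a, 't::ab_group_add, 'u) tensor_powers \<Rightarrow> ('a \<Rightarrow> 'a) \<Rightarrow> ('a \<Rightarrow> 'a) \<Rightarrow> 't \<Rightarrow> 't" where
  "tmap V = tensor_map (smult2 V) (ten V) (smult2 V) (ten V)"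

definition tmap_toL ::
  "('k::field, 'a, 't::ab_group_add, 'u::ab_group_add) tensor_powers \<Rightarrow>
   ('a \<Rightarrow> 't) \<Rightarrow> ('a \<Rightarrow> 'a) \<Rightarrow> 't \<Rightarrow> 'u" where
  "tmap_toL V = tensor_map (smult2 V) (ten V) (smult3 V) (tenL V)"

definition tmap_toR ::
  "('k::field, 'a, 't::ab_group_add, 'u::ab_group_add) tensor_powers \<Rightarrow>
   ('a \<Rightarrow> 'a) \<Rightarrow> ('a \<Rightarrow> 't) \<Rightarrow> 't \<Rightarrow> 'u" where
  "tmap_toR V = tensor_map (smult2 V) (ten V) (smult3 V) (tenR V)"

definition tmap_fromL ::
  "('k::field, 'a, 't::ab_group_add, 'u::ab_group_add) tensor_powers \<Rightarrow>
   ('t \<Rightarrow> 'a) \<Rightarrow> ('a \<Rightarrow> 'a) \<Rightarrow> 'u \<Rightarrow> 't" where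
  "tmap_fromL V = tensor_map (smult3 V) (tenL V) (smult2 V) (ten V)"

definition tmap_fromR ::
  "('k::field, 'a, 't::ab_group_add, 'u::ab_group_add) tensor_powers \<Rightarrow>
   ('a \<Rightarrow> 'a) \<Rightarrow> ('t \<Rightarrow> 'a) \<Rightarrow> 'u \<Rightarrow> 't" where
  "tmap_fromR V = tensor_map (smult3 V) (tenR V) (smult2 V) (ten V)"

definition twist :: "('k::field, 'a, 't::ab_group_add, 'u) tensor_powers \<Rightarrow> 't \<Rightarrow> 't" where
  "twist V = tensor_lift (smult2 V) (ten V) (smult2 V) (\<lambda>x y. ten V y x)"

section \<open>Infinitesimal Hom-bialgebras and the balanceator\<close>

definition eps_hom_bialgebra ::
  "('k::field, 'a::ab_group_add, 't::ab_group_add, 'u::ab_group_add) tensor_powers \<Rightarrow>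
   ('t \<Rightarrow> 'a) \<Rightarrow> ('a \<Rightarrow> 't) \<Rightarrow> ('a \<Rightarrow> 'a) \<Rightarrow> bool" where
  "eps_hom_bialgebra V \<mu> \<Delta> \<alpha> \<longleftrightarrow>
     Vector_Spaces.linear (smult2 V) (smult V) \<mu> \<and>
     Vector_Spaces.linear (smult V) (smult2 V) \<Delta> \<and>
     Vector_Spaces.linear (smult V) (smult V) \<alpha> \<and>
     \<alpha> \<circ> \<mu> = \<mu> \<circ> tmap V \<alpha> \<alpha> \<and>
     \<mu> \<circ> tmap_fromR V \<alpha> \<mu> = \<mu> \<circ> tmap_fromL V \<mu> \<alpha> \<and>
     tmap V \<alpha> \<alpha> \<circ> \<Delta> = \<Delta> \<circ> \<alpha> \<and>
     tmap_toR V \<alpha> \<Delta> \<circ> \<Delta> = tmap_toL V \<Delta> \<alpha> \<circ> \<Delta> \<and>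
     \<Delta> \<circ> \<mu> = (\<lambda>w. (tmap_fromL V \<mu> \<alpha> \<circ> tmap_toR V \<alpha> \<Delta>) w + (tmap_fromR V \<alpha> \<mu> \<circ> tmap_toL V \<Delta> \<alpha>) w)"

definition eps_bialgebra ::
  "('k::field, 'a::ab_group_add, 't::ab_group_add, 'u::ab_group_add) tensor_powers \<Rightarrow>
   ('t \<Rightarrow> 'a) \<Rightarrow> ('a \<Rightarrow> 't) \<Rightarrow> bool" where
  "eps_bialgebra V \<mu> \<Delta> \<longleftrightarrow> eps_hom_bialgebra V \<mu> \<Delta> id"

text \<open>Morphisms from an \<open>\<epsilon>\<close>-bialgebra to itself.\<close>

definition eps_bialgebra_endo ::
  "('k::field, 'a::ab_group_add, 't::ab_group_add, 'u::ab_group_add) tensor_powers \<Rightarrow>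
   ('t \<Rightarrow> 'a) \<Rightarrow> ('a \<Rightarrow> 't) \<Rightarrow> ('a \<Rightarrow> 'a) \<Rightarrow> bool" where
  "eps_bialgebra_endo V \<mu> \<Delta> \<alpha> \<longleftrightarrow>
     Vector_Spaces.linear (smult V) (smult V) \<alpha> \<and>
     \<alpha> \<circ> \<mu> = \<mu> \<circ> tmap V \<alpha> \<alpha> \<and>
     \<Delta> \<circ> \<alpha> = tmap V \<alpha> \<alpha> \<circ> \<Delta>"

text \<open>\<open>[a, b]\<^sub>\<bullet>\<close>, where \<open>(x \<mapsto> \<mu> (\<alpha> a \<otimes> x)) \<otimes> \<alpha>\<close> and \<open>\<alpha> \<otimes> (x \<mapsto> \<mu> (x \<otimes> \<alpha> a))\<close> take the
  place of the sums over \<open>b = \<Sum> b\<^sub>1 \<otimes> b\<^sub>2\<close>.\<close>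

definition bullet_bracket ::
  "('k::field, 'a, 't::ab_group_add, 'u) tensor_powers \<Rightarrow>
   ('t \<Rightarrow> 'a) \<Rightarrow> ('a \<Rightarrow> 'a) \<Rightarrow> 'a \<Rightarrow> 't \<Rightarrow> 't" where
  "bullet_bracket V \<mu> \<alpha> a b =
     tmap V (\<lambda>x. \<mu> (ten V (\<alpha> a) x)) \<alpha> b - tmap V \<alpha> (\<lambda>x. \<mu> (ten V x (\<alpha> a))) b"

text \<open>The linear map \<open>B\<close> on \<open>A \<otimes> A\<close>; \<open>B(x, y)\<close> is its value at \<open>x \<otimes> y\<close>.\<close>

definition balanceator ::
  "('k::field, 'a, 't::ab_group_add, 'u) tensor_powers \<Rightarrow>
   ('t \<Rightarrow> 'a) \<Rightarrow> ('a \<Rightarrow> 't) \<Rightarrow> ('a \<Rightarrow> 'a) \<Rightarrow> 't \<Rightarrow> 't" where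
  "balanceator V \<mu> \<Delta> \<alpha> = tensor_lift (smult2 V) (ten V) (smult2 V)
     (\<lambda>x y. bullet_bracket V \<mu> \<alpha> x ((twist V \<circ> \<Delta>) y)
          + twist V (bullet_bracket V \<mu> \<alpha> y ((twist V \<circ> \<Delta>) x)))"

definition symmetric_balanceator ::
  "('k, 'a, 't, 'u) tensor_powers \<Rightarrow> ('t \<Rightarrow> 't) \<Rightarrow> bool" where
  "symmetric_balanceator V B \<longleftrightarrow> (\<forall>x y. B (ten V x y) = B (ten V y x))"

section \<open>The maps above on pure tensors, and the twisted bialgebra\<close>

text \<open>\<open>linij\<close>: linear maps from the \<open>i\<close>-th to the \<open>j\<close>-th tensor power.\<close>

abbreviation (input) "lin11 V \<equiv> Vector_Spaces.linear (smult V) (smult V)"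
abbreviation (input) "lin12 V \<equiv> Vector_Spaces.linear (smult V) (smult2 V)"
abbreviation (input) "lin21 V \<equiv> Vector_Spaces.linear (smult2 V) (smult V)"
abbreviation (input) "lin22 V \<equiv> Vector_Spaces.linear (smult2 V) (smult2 V)"

lemma is_tensor_powers_vector_space:
  assumes "is_tensor_powers V"
  shows "vector_space (smult V)" "vector_space (smult2 V)" "vector_space (smult3 V)"
  using assms by (auto simp: is_tensor_powers_def is_tensor_product_def)

context
  fixes V :: "('k::field, 'a::ab_group_add, 't::ab_group_add, 'u::ab_group_add) tensor_powers"
  assumes V: "is_tensor_powers V"
begin

lemma V12: "is_tensor_product (smult V) (smult V) (smult2 V) (ten V)"
  and VL: "is_tensor_product (smult2 V) (smult V) (smult3 V) (tenL V)"
  and VR: "is_tensor_product (smult V) (smult2 V) (smult3 V) (tenR V)"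
  and VLR: "tenL V (ten V x y) z = tenR V x (ten V y z)"
  using V by (auto simp: is_tensor_powers_def)

lemmas vector_spaces = is_tensor_powers_vector_space[OF V]

lemma ten_linear: "lin12 V (\<lambda>y. ten V x y)" "lin12 V (\<lambda>x. ten V x y)"
  using is_tensor_product_bilinear[OF V12] by (auto simp: bilinear_map_def)

lemma tmap_apply:
  "lin11 V f \<Longrightarrow> lin11 V g \<Longrightarrow> tmap V f g (ten V x y) = ten V (f x) (g y)"
  unfolding tmap_def by (rule tensor_map_apply[OF V12 V12])

lemma tmap_linear: "lin11 V f \<Longrightarrow> lin11 V g \<Longrightarrow> lin22 V (tmap V f g)"
  unfolding tmap_def by (rule tensor_map_linear[OF V12 V12])

lemma twist_bilinear: "bilinear_map (smult V) (smult V) (smult2 V) (\<lambda>x y. ten V y x)"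
  using ten_linear by (auto simp: bilinear_map_def)

lemma twist_apply: "twist V (ten V x y) = ten V y x"
  unfolding twist_def by (rule tensor_lift_apply[OF V12 twist_bilinear])

lemma twist_linear: "lin22 V (twist V)"
  unfolding twist_def by (rule tensor_lift_linear[OF V12 twist_bilinear])

lemma tensor_square_ext:
  "Vector_Spaces.linear (smult2 V) sW g \<Longrightarrow> Vector_Spaces.linear (smult2 V) sW h \<Longrightarrow>
   (\<And>x y. g (ten V x y) = h (ten V x y)) \<Longrightarrow> g = h"
  by (rule tensor_product_ext[OF V12])

lemma linear_comp_fun:
  "Vector_Spaces.linear s1 s2 f \<Longrightarrow> Vector_Spaces.linear s2 s3 g \<Longrightarrow> Vector_Spaces.linear s1 s3 (\<lambda>x. g (f x))"
  by (auto simp: Vector_Spaces.linear_iff)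

lemma linear_add_fun:
  "Vector_Spaces.linear s1 s2 f \<Longrightarrow> Vector_Spaces.linear s1 s2 g \<Longrightarrow> Vector_Spaces.linear s1 s2 (\<lambda>x. f x + g x)"
  by (auto simp: Vector_Spaces.linear_iff vector_space.vector_space_assms algebra_simps)

lemma linear_scale_fun:
  "Vector_Spaces.linear s1 s2 f \<Longrightarrow> Vector_Spaces.linear s1 s2 (\<lambda>x. s2 c (f x))"
  by (auto simp: Vector_Spaces.linear_iff vector_space.vector_space_assms mult.commute)

lemma linear_diff_fun:
  "Vector_Spaces.linear s1 s2 f \<Longrightarrow> Vector_Spaces.linear s1 s2 g \<Longrightarrow> Vector_Spaces.linear s1 s2 (\<lambda>x. f x - g x)"
  by (auto simp: Vector_Spaces.linear_iff module.scale_right_diff_distrib module_iff_vector_space)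

lemma tmap_param1:
  assumes F: "\<And>a. lin11 V (F a)" "\<And>z. lin11 V (\<lambda>a. F a z)" and g: "lin11 V g"
  shows "lin12 V (\<lambda>a. tmap V (F a) g b)"
proof -
  have l: "lin22 V (tmap V (F a) g)" for a by (intro tmap_linear F g)
  have s: "F (a + a') z = F a z + F a' z" "F (smult V c a) z = smult V c (F a z)" for a a' c z
    using F(2) by (auto simp: Vector_Spaces.linear_iff)
  have r: "ten V (x + x') y = ten V x y + ten V x' y" "ten V (smult V c x) y = smult2 V c (ten V x y)"
    "ten V y (x + x') = ten V y x + ten V y x'"
    "ten V y (smult V c x) = smult2 V c (ten V y x)" for x x' y c
    using ten_linear by (auto simp: Vector_Spaces.linear_iff)
  have "tmap V (F (a + a')) g = (\<lambda>b. tmap V (F a) g b + tmap V (F a') g b)" for a a'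
    by (rule tensor_square_ext[OF l linear_add_fun[OF l l]]) (simp add: tmap_apply F(1) g s r)
  moreover have "tmap V (F (smult V c a)) g = (\<lambda>b. smult2 V c (tmap V (F a) g b))" for a c
    by (rule tensor_square_ext[OF l linear_scale_fun[OF l]]) (simp add: tmap_apply F(1) g s r)
  ultimately show ?thesis by (simp add: Vector_Spaces.linear_iff vector_spaces)
qed

lemma tmap_param2:
  assumes F: "\<And>a. lin11 V (F a)" "\<And>z. lin11 V (\<lambda>a. F a z)" and g: "lin11 V g"
  shows "lin12 V (\<lambda>a. tmap V g (F a) b)"
proof -
  have l: "lin22 V (tmap V g (F a))" for a by (intro tmap_linear F g)
  have s: "F (a + a') z = F a z + F a' z" "F (smult V c a) z = smult V c (F a z)" for a a' c z
    using F(2) by (auto simp: Vector_Spaces.linear_iff)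
  have r: "ten V (x + x') y = ten V x y + ten V x' y" "ten V (smult V c x) y = smult2 V c (ten V x y)"
    "ten V y (x + x') = ten V y x + ten V y x'"
    "ten V y (smult V c x) = smult2 V c (ten V y x)" for x x' y c
    using ten_linear by (auto simp: Vector_Spaces.linear_iff)
  have "tmap V g (F (a + a')) = (\<lambda>b. tmap V g (F a) b + tmap V g (F a') b)" for a a'
    by (rule tensor_square_ext[OF l linear_add_fun[OF l l]]) (simp add: tmap_apply F(1) g s r)
  moreover have "tmap V g (F (smult V c a)) = (\<lambda>b. smult2 V c (tmap V g (F a) b))" for a c
    by (rule tensor_square_ext[OF l linear_scale_fun[OF l]]) (simp add: tmap_apply F(1) g s r)
  ultimately show ?thesis by (simp add: Vector_Spaces.linear_iff vector_spaces)
qed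

lemma linear_mult:
  "lin21 V \<mu> \<Longrightarrow> lin11 V \<alpha> \<Longrightarrow> lin11 V (\<lambda>x. \<mu> (ten V (\<alpha> a) x))"
  "lin21 V \<mu> \<Longrightarrow> lin11 V \<alpha> \<Longrightarrow> lin11 V (\<lambda>a. \<mu> (ten V (\<alpha> a) x))"
  "lin21 V \<mu> \<Longrightarrow> lin11 V \<alpha> \<Longrightarrow> lin11 V (\<lambda>x. \<mu> (ten V x (\<alpha> a)))"
  "lin21 V \<mu> \<Longrightarrow> lin11 V \<alpha> \<Longrightarrow> lin11 V (\<lambda>a. \<mu> (ten V x (\<alpha> a)))"
  using ten_linear by (auto simp: Vector_Spaces.linear_iff)

lemma bullet_bracket_apply:
  "lin21 V \<mu> \<Longrightarrow> lin11 V \<alpha> \<Longrightarrow>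
   bullet_bracket V \<mu> \<alpha> a (ten V x y) = ten V (\<mu> (ten V (\<alpha> a) x)) (\<alpha> y) - ten V (\<alpha> x) (\<mu> (ten V y (\<alpha> a)))"
  by (simp add: bullet_bracket_def tmap_apply linear_mult)

lemma bullet_bracket_linear:
  "lin21 V \<mu> \<Longrightarrow> lin11 V \<alpha> \<Longrightarrow> lin22 V (bullet_bracket V \<mu> \<alpha> a)"
  "lin21 V \<mu> \<Longrightarrow> lin11 V \<alpha> \<Longrightarrow> lin12 V (\<lambda>a. bullet_bracket V \<mu> \<alpha> a b)"
  unfolding bullet_bracket_def
  by (intro linear_diff_fun tmap_linear linear_mult tmap_param1 tmap_param2; assumption)+

lemma balanceator_bilinear:
  assumes "lin21 V \<mu>" "lin12 V \<Delta>" "lin11 V \<alpha>"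
  shows "bilinear_map (smult V) (smult V) (smult2 V) (\<lambda>x y. bullet_bracket V \<mu> \<alpha> x ((twist V \<circ> \<Delta>) y)
          + twist V (bullet_bracket V \<mu> \<alpha> y ((twist V \<circ> \<Delta>) x)))"
  unfolding bilinear_map_def o_def
  apply (intro conjI allI linear_add_fun)
  by (rule linear_comp_fun[OF _ twist_linear]
      linear_comp_fun[OF linear_comp_fun[OF assms(2) twist_linear]] bullet_bracket_linear assms)+

lemma
  assumes "lin21 V \<mu>" "lin12 V \<Delta>"
    and "lin11 V \<alpha>"
  shows balanceator_apply: "balanceator V \<mu> \<Delta> \<alpha> (ten V x y) =
      bullet_bracket V \<mu> \<alpha> x ((twist V \<circ> \<Delta>) y) + twist V (bullet_bracket V \<mu> \<alpha> y ((twist V \<circ> \<Delta>) x))"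
    and balanceator_linear: "lin22 V (balanceator V \<mu> \<Delta> \<alpha>)"
  unfolding balanceator_def
  using tensor_lift_apply[OF V12 balanceator_bilinear[OF assms]]
    tensor_lift_linear[OF V12 balanceator_bilinear[OF assms]] by auto

text \<open>The \<open>\<epsilon>\<close>-Hom-bialgebra \<open>A\<^sub>\<alpha>\<close>.\<close>

theorem eps_hom_bialgebra_twisted:
  assumes b: "eps_bialgebra V \<mu> \<Delta>" and e: "eps_bialgebra_endo V \<mu> \<Delta> \<alpha>"
  shows "eps_hom_bialgebra V (\<alpha> \<circ> \<mu>) (\<Delta> \<circ> \<alpha>) \<alpha>"
proof -
  let ?T = "tmap V \<alpha> \<alpha>"
  let ?TL = "tensor_map (smult3 V) (tenL V) (smult3 V) (tenL V) ?T \<alpha>"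
  let ?TR = "tensor_map (smult3 V) (tenR V) (smult3 V) (tenR V) \<alpha> ?T"
  have m: "lin21 V \<mu>"
    and d: "lin12 V \<Delta>"
    and i: "lin11 V id"
    and ass: "\<And>z. \<mu> (tmap_fromR V id \<mu> z) = \<mu> (tmap_fromL V \<mu> id z)"
    and coass: "\<And>z. tmap_toR V id \<Delta> (\<Delta> z) = tmap_toL V \<Delta> id (\<Delta> z)"
    and cp: "\<And>z. \<Delta> (\<mu> z) = tmap_fromL V \<mu> id (tmap_toR V id \<Delta> z) + tmap_fromR V id \<mu> (tmap_toL V \<Delta> id z)"
    using b by (simp_all add: eps_bialgebra_def eps_hom_bialgebra_def fun_eq_iff)
  have a: "lin11 V \<alpha>"
    and am: "\<alpha> \<circ> \<mu> = \<mu> \<circ> ?T" and ad: "\<Delta> \<circ> \<alpha> = ?T \<circ> \<Delta>"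
    using e by (auto simp: eps_bialgebra_endo_def)
  note am' = am[THEN fun_cong, unfolded o_apply] and ad' = ad[THEN fun_cong, unfolded o_apply]
  have T: "lin22 V ?T" by (intro tmap_linear a)
  note comps = tensor_map_comp[OF VL VL V12] tensor_map_comp[OF VR VR V12] tensor_map_comp[OF VL V12 V12]
    tensor_map_comp[OF VR V12 V12] tensor_map_comp[OF V12 VL VL] tensor_map_comp[OF V12 VR VR]
    tensor_map_comp[OF V12 V12 VL] tensor_map_comp[OF V12 V12 VR]
  note defs = tmap_def tmap_toL_def tmap_toR_def tmap_fromL_def tmap_fromR_def
  have fR: "tmap_fromR V \<alpha> (\<alpha> \<circ> \<mu>) z = ?T (tmap_fromR V id \<mu> z)"
    and fL: "tmap_fromL V (\<alpha> \<circ> \<mu>) \<alpha> z = ?T (tmap_fromL V \<mu> id z)"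
    and fR': "tmap_fromR V \<alpha> (\<mu> \<circ> ?T) z = tmap_fromR V id \<mu> (?TR z)"
    and fL': "tmap_fromL V (\<mu> \<circ> ?T) \<alpha> z = tmap_fromL V \<mu> id (?TL z)"
    and tR: "tmap_toR V \<alpha> (\<Delta> \<circ> \<alpha>) w = tmap_toR V id \<Delta> (?T w)"
    and tL: "tmap_toL V (\<Delta> \<circ> \<alpha>) \<alpha> w = tmap_toL V \<Delta> id (?T w)"
    and tR': "tmap_toR V \<alpha> (?T \<circ> \<Delta>) w = ?TR (tmap_toR V id \<Delta> w)"
    and tL': "tmap_toL V (?T \<circ> \<Delta>) \<alpha> w = ?TL (tmap_toL V \<Delta> id w)" for z w
    unfolding defs using T[unfolded defs] by (simp_all add: comps m d i a)
  have TL: "Vector_Spaces.linear (smult3 V) (smult3 V) ?TL" by (rule tensor_map_linear[OF VL VL T a])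
  have TR: "Vector_Spaces.linear (smult3 V) (smult3 V) ?TR" by (rule tensor_map_linear[OF VR VR a T])
  have "?TL (tenL V z w) = ?TR (tenL V z w)" for z w
  proof -
    have l: "Vector_Spaces.linear (smult2 V) (smult3 V) (\<lambda>z. tenL V z w)" for w
      using is_tensor_product_bilinear[OF VL] by (auto simp: bilinear_map_def)
    have "(\<lambda>z. ?TL (tenL V z w)) = (\<lambda>z. ?TR (tenL V z w))"
    proof (rule tensor_square_ext[OF linear_comp_fun[OF l TL] linear_comp_fun[OF l TR]])
      fix x y
      have "?TL (tenL V (ten V x y) w) = tenL V (ten V (\<alpha> x) (\<alpha> y)) (\<alpha> w)"
        by (simp add: tensor_map_apply[OF VL VL T a] tmap_apply a)
      also have "\<dots> = tenR V (\<alpha> x) (ten V (\<alpha> y) (\<alpha> w))"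
        by (rule VLR)
      also have "\<dots> = ?TR (tenR V x (ten V y w))"
        by (simp add: tensor_map_apply[OF VR VR a T] tmap_apply a)
      finally show "?TL (tenL V (ten V x y) w) = ?TR (tenL V (ten V x y) w)"
        by (simp add: VLR)
    qed
    then show ?thesis by (rule fun_cong)
  qed
  then have TLR: "?TL = ?TR" by (rule tensor_product_ext[OF VL TL TR])
  have 1: "?T (tmap_fromL V \<mu> id (tmap_toR V id \<Delta> w)) = tmap_fromL V \<mu> id (tmap_toR V id \<Delta> (?T w))" for w
    unfolding fL[symmetric] tR[symmetric] am ad fL' tR' TLR ..
  have 2: "?T (tmap_fromR V id \<mu> (tmap_toL V \<Delta> id w)) = tmap_fromR V id \<mu> (tmap_toL V \<Delta> id (?T w))" for w
    unfolding fR[symmetric] tL[symmetric] am ad fR' tL' TLR ..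
  show ?thesis
    unfolding eps_hom_bialgebra_def
  proof (intro conjI)
    show "lin21 V (\<alpha> \<circ> \<mu>)" "lin12 V (\<Delta> \<circ> \<alpha>)"
      "lin11 V \<alpha>"
      using m d a by (auto simp: Vector_Spaces.linear_iff)
    show "\<alpha> \<circ> (\<alpha> \<circ> \<mu>) = \<alpha> \<circ> \<mu> \<circ> ?T" by (simp add: am fun_eq_iff am')
    show "\<alpha> \<circ> \<mu> \<circ> tmap_fromR V \<alpha> (\<alpha> \<circ> \<mu>) = \<alpha> \<circ> \<mu> \<circ> tmap_fromL V (\<alpha> \<circ> \<mu>) \<alpha>"
      by (simp add: fun_eq_iff fR fL flip: am') (simp add: ass)
    show "?T \<circ> (\<Delta> \<circ> \<alpha>) = \<Delta> \<circ> \<alpha> \<circ> \<alpha>" by (simp add: fun_eq_iff ad')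
    show "tmap_toR V \<alpha> (\<Delta> \<circ> \<alpha>) \<circ> (\<Delta> \<circ> \<alpha>) = tmap_toL V (\<Delta> \<circ> \<alpha>) \<alpha> \<circ> (\<Delta> \<circ> \<alpha>)"
      by (simp add: fun_eq_iff tR tL flip: ad') (simp add: coass)
    show "\<Delta> \<circ> \<alpha> \<circ> (\<alpha> \<circ> \<mu>) = (\<lambda>w. (tmap_fromL V (\<alpha> \<circ> \<mu>) \<alpha> \<circ> tmap_toR V \<alpha> (\<Delta> \<circ> \<alpha>)) w +
        (tmap_fromR V \<alpha> (\<alpha> \<circ> \<mu>) \<circ> tmap_toL V (\<Delta> \<circ> \<alpha>) \<alpha>) w)"
      by (simp add: fun_eq_iff fL fR tL tR 1 2 am' cp)
  qed
qed

end

end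

theory Submission
  imports Defs
begin

text \<open>Everything in sight is linear, so identities can be tested on pure tensors. Since
  \<Delta> intertwines \<alpha> with \<alpha> \<otimes> \<alpha> and the twist is natural, the
  opposite comultiplication of A_\<alpha> at y is (\<alpha> \<otimes> \<alpha>)(\<Delta>^op(y)).
  Feeding this to the bracket of A_\<alpha>, multiplicativity of \<alpha> gathers two copies of
  \<alpha> on each tensor factor, so \<alpha>^2 \<otimes> \<alpha>^2 comes out of the bracket of A
  (\<open>bullet_bracket_twisted\<close>). It also passes through the outer twist
  (\<open>twist_tmap\<close>), which yields the formula for B_\<alpha>. Symmetry is then inherited
  by applying \<alpha>^2 \<otimes> \<alpha>^2, and recovered by cancelling its two factors \<alpha>
  \<otimes> \<alpha>.\<close>

lemma linear_map_comp:
  "Vector_Spaces.linear s1 s2 f \<Longrightarrow> Vector_Spaces.linear s2 s3 g \<Longrightarrow> Vector_Spaces.linear s1 s3 (g \<circ> f)"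
  by (auto simp: Vector_Spaces.linear_iff)

context
  fixes V :: "('k::field, 'a::ab_group_add, 't::ab_group_add, 'u::ab_group_add) tensor_powers"
  assumes V: "is_tensor_powers V"
begin

lemma tmap_tmap:
  assumes "lin11 V f" "lin11 V g" "lin11 V f'" "lin11 V g'"
  shows "tmap V f' g' (tmap V f g z) = tmap V (f' \<circ> f) (g' \<circ> g) z"
  unfolding tmap_def by (rule tensor_map_comp[OF V12[OF V] V12[OF V] V12[OF V] assms])

text \<open>Naturality of the twist. It serves twice: with \<alpha> inside \<Delta>^op, and with
  \<alpha>^2 for the outer twist in the balanceator.\<close>

lemma twist_tmap:
  assumes f: "lin11 V f" and g: "lin11 V g"
  shows "twist V (tmap V f g z) = tmap V g f (twist V z)"
proof -
  have "(\<lambda>z. twist V (tmap V f g z)) = (\<lambda>z. tmap V g f (twist V z))"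
    by (rule tensor_square_ext[OF V linear_comp_fun[OF V tmap_linear[OF V f g] twist_linear[OF V]]
          linear_comp_fun[OF V twist_linear[OF V] tmap_linear[OF V g f]]])
      (simp add: tmap_apply[OF V] twist_apply[OF V] f g)
  then show ?thesis by (rule fun_cong)
qed

text \<open>For b = y \<otimes> z both sides equal \<alpha>^2(xy) \<otimes> \<alpha>^2(z) -
  \<alpha>^2(y) \<otimes> \<alpha>^2(zx). One \<alpha> comes from the structure map or the twisted
  product, the other from the argument (\<alpha> \<otimes> \<alpha>)(b) and, in the products, from
  multiplicativity.\<close>

lemma bullet_bracket_twisted:
  assumes m: "lin21 V \<mu>" and a: "lin11 V \<alpha>" and am: "\<alpha> \<circ> \<mu> = \<mu> \<circ> tmap V \<alpha> \<alpha>"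
  shows "bullet_bracket V (\<alpha> \<circ> \<mu>) \<alpha> x (tmap V \<alpha> \<alpha> b)
    = tmap V (\<alpha> \<circ> \<alpha>) (\<alpha> \<circ> \<alpha>) (bullet_bracket V \<mu> id x b)"
proof -
  have i: "lin11 V id"
    using vector_spaces(1)[OF V] by (simp add: Vector_Spaces.linear_iff)
  have aa: "lin11 V (\<alpha> \<circ> \<alpha>)" and ma: "lin21 V (\<alpha> \<circ> \<mu>)"
    using linear_map_comp[OF a a] linear_map_comp[OF m a] .
  have T: "lin22 V (tmap V \<alpha> \<alpha>)" and TT: "lin22 V (tmap V (\<alpha> \<circ> \<alpha>) (\<alpha> \<circ> \<alpha>))"
    by (intro tmap_linear[OF V] a aa)+
  interpret TT: Vector_Spaces.linear "smult2 V" "smult2 V" "tmap V (\<alpha> \<circ> \<alpha>) (\<alpha> \<circ> \<alpha>)"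
    by (rule TT)
  have \<mu>: "\<mu> (ten V (\<alpha> y) (\<alpha> z)) = \<alpha> (\<mu> (ten V y z))" for y z
    using fun_cong[OF am, of "ten V y z"] by (simp add: tmap_apply[OF V a a])
  have "(\<lambda>b. bullet_bracket V (\<alpha> \<circ> \<mu>) \<alpha> x (tmap V \<alpha> \<alpha> b))
      = (\<lambda>b. tmap V (\<alpha> \<circ> \<alpha>) (\<alpha> \<circ> \<alpha>) (bullet_bracket V \<mu> id x b))"
  proof (rule tensor_square_ext[OF V])
    show "lin22 V (\<lambda>b. bullet_bracket V (\<alpha> \<circ> \<mu>) \<alpha> x (tmap V \<alpha> \<alpha> b))"
      by (rule linear_comp_fun[OF V T bullet_bracket_linear(1)[OF V ma a]])
    show "lin22 V (\<lambda>b. tmap V (\<alpha> \<circ> \<alpha>) (\<alpha> \<circ> \<alpha>) (bullet_bracket V \<mu> id x b))"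
      by (rule linear_comp_fun[OF V bullet_bracket_linear(1)[OF V m i] TT])
  qed (simp add: tmap_apply[OF V a a] tmap_apply[OF V aa aa] bullet_bracket_apply[OF V ma a]
      bullet_bracket_apply[OF V m i] \<mu> TT.diff)
  then show ?thesis by (rule fun_cong)
qed

lemma balanceator_twisted:
  assumes m: "lin21 V \<mu>" and d: "lin12 V \<Delta>" and a: "lin11 V \<alpha>"
    and am: "\<alpha> \<circ> \<mu> = \<mu> \<circ> tmap V \<alpha> \<alpha>" and ad: "\<Delta> \<circ> \<alpha> = tmap V \<alpha> \<alpha> \<circ> \<Delta>"
  shows "balanceator V (\<alpha> \<circ> \<mu>) (\<Delta> \<circ> \<alpha>) \<alpha> = tmap V (\<alpha> \<circ> \<alpha>) (\<alpha> \<circ> \<alpha>) \<circ> balanceator V \<mu> \<Delta> id"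
proof (rule tensor_square_ext[OF V])
  have i: "lin11 V id"
    using vector_spaces(1)[OF V] by (simp add: Vector_Spaces.linear_iff)
  have aa: "lin11 V (\<alpha> \<circ> \<alpha>)" and ma: "lin21 V (\<alpha> \<circ> \<mu>)" and da: "lin12 V (\<Delta> \<circ> \<alpha>)"
    using linear_map_comp[OF a a] linear_map_comp[OF m a] linear_map_comp[OF a d] .
  interpret TT: Vector_Spaces.linear "smult2 V" "smult2 V" "tmap V (\<alpha> \<circ> \<alpha>) (\<alpha> \<circ> \<alpha>)"
    by (intro tmap_linear[OF V] aa)
  show "lin22 V (balanceator V (\<alpha> \<circ> \<mu>) (\<Delta> \<circ> \<alpha>) \<alpha>)"
    by (rule balanceator_linear[OF V ma da a])
  show "lin22 V (tmap V (\<alpha> \<circ> \<alpha>) (\<alpha> \<circ> \<alpha>) \<circ> balanceator V \<mu> \<Delta> id)"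
    by (rule linear_map_comp[OF balanceator_linear[OF V m d i] tmap_linear[OF V aa aa]])
  fix x y
  \<comment> \<open>This puts the second argument of each bracket into the shape that
    \<open>bullet_bracket_twisted\<close> requires.\<close>
  have op: "(twist V \<circ> (\<Delta> \<circ> \<alpha>)) z = tmap V \<alpha> \<alpha> ((twist V \<circ> \<Delta>) z)" for z
    by (simp add: ad twist_tmap[OF a a])
  show "balanceator V (\<alpha> \<circ> \<mu>) (\<Delta> \<circ> \<alpha>) \<alpha> (ten V x y)
      = (tmap V (\<alpha> \<circ> \<alpha>) (\<alpha> \<circ> \<alpha>) \<circ> balanceator V \<mu> \<Delta> id) (ten V x y)"
    \<comment> \<open>Only the outermost composition is opened; the others must stay folded for
      \<open>op\<close> and \<open>bullet_bracket_twisted\<close> to match.\<close>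
    unfolding o_apply[of "tmap V (\<alpha> \<circ> \<alpha>) (\<alpha> \<circ> \<alpha>)"] balanceator_apply[OF V ma da a]
      balanceator_apply[OF V m d i] op bullet_bracket_twisted[OF m a am] twist_tmap[OF aa aa] TT.add ..
qed

end

theorem theorem6p5:
  fixes V :: "('k::field_char_0, 'a::ab_group_add, 't::ab_group_add, 'u::ab_group_add) tensor_powers"
    and \<mu> :: "'t \<Rightarrow> 'a" and \<Delta> :: "'a \<Rightarrow> 't" and \<alpha> :: "'a \<Rightarrow> 'a"
  assumes "is_tensor_powers V"
    and "eps_bialgebra V \<mu> \<Delta>"
    and "eps_bialgebra_endo V \<mu> \<Delta> \<alpha>"
  defines "B \<equiv> balanceator V \<mu> \<Delta> id"
    and "B\<^sub>\<alpha> \<equiv> balanceator V (\<alpha> \<circ> \<mu>) (\<Delta> \<circ> \<alpha>) \<alpha>"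
  shows "B\<^sub>\<alpha> = tmap V (\<alpha> \<circ> \<alpha>) (\<alpha> \<circ> \<alpha>) \<circ> B
    \<and> (symmetric_balanceator V B \<longrightarrow> symmetric_balanceator V B\<^sub>\<alpha>)
    \<and> (symmetric_balanceator V B\<^sub>\<alpha> \<and> inj (tmap V \<alpha> \<alpha>) \<longrightarrow> symmetric_balanceator V B)"
proof (intro conjI impI)
  have m: "lin21 V \<mu>" and d: "lin12 V \<Delta>"
    using assms(2) by (simp_all add: eps_bialgebra_def eps_hom_bialgebra_def)
  have a: "lin11 V \<alpha>" and am: "\<alpha> \<circ> \<mu> = \<mu> \<circ> tmap V \<alpha> \<alpha>" and ad: "\<Delta> \<circ> \<alpha> = tmap V \<alpha> \<alpha> \<circ> \<Delta>"
    using assms(3) by (simp_all add: eps_bialgebra_endo_def)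
  show eq: "B\<^sub>\<alpha> = tmap V (\<alpha> \<circ> \<alpha>) (\<alpha> \<circ> \<alpha>) \<circ> B"
    unfolding B_def B\<^sub>\<alpha>_def by (rule balanceator_twisted[OF assms(1) m d a am ad])
  show "symmetric_balanceator V B\<^sub>\<alpha>" if "symmetric_balanceator V B"
    using that by (simp add: eq symmetric_balanceator_def)
  \<comment> \<open>By functoriality \<alpha>^2 \<otimes> \<alpha>^2 is the square of \<alpha>
    \<otimes> \<alpha>, so injectivity of the latter can be used twice to cancel it.\<close>
  have "tmap V (\<alpha> \<circ> \<alpha>) (\<alpha> \<circ> \<alpha>) z = tmap V \<alpha> \<alpha> (tmap V \<alpha> \<alpha> z)" for z
    by (simp add: tmap_tmap[OF assms(1) a a a a])
  then show "symmetric_balanceator V B" if "symmetric_balanceator V B\<^sub>\<alpha> \<and> inj (tmap V \<alpha> \<alpha>)"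
    using that unfolding eq symmetric_balanceator_def by (auto simp: inj_eq)
qed

end
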